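(* Let $V$ be a vector space and let $f(x_1,x_2),\,g(x_1,x_2),\,h(x_1,x_2)\in V((x_1))((x_2))$. Consider the following statements. (A) $$x_0^{-1}\delta\left(\frac{x_1-x_2}{x_0}\right)f(x_1,x_2)-x_0^{-1}\delta\left(\frac{-x_2+x_1}{x_0}\right)g(x_2,x_1)-x_1^{-1}\delta\left(\frac{x_2+x_0}{x_1}\right)h(x_2,x_0)=0.$$ (B) There exists $m_1\ge0$ such that $(x_1-x_2)^{m_1}(f(x_1,x_2)-g(x_2,x_1))=0$. (C) There exists $m_2\ge0$ such that $(x_0+x_2)^{m_2}(f(x_0+x_2,x_2)-h(x_2,x_0))=0$. (D) There exists $m_3\ge0$ such that $(x_1-x_0)^{m_3}(g(-x_0+x_1,x_1)-h(x_1-x_0,x_0))=0$. (E) There exist $p_1(x_1,x_2)\in V[[x_1,x_2]]$ and integers $a_1,b_1,c_1\ge0$ such that $$f(x_1,x_2)=\frac{p_1(x_1,x_2)}{(x_1-x_2)^{a_1}x_1^{b_1}x_2^{c_1}}\quad\text{and}\quad g(x_2,x_1)=\frac{p_1(x_1,x_2)}{(-x_2+x_1)^{a_1}x_1^{b_1}x_2^{c_1}}.$$ (F) There exist $p_2(x_0,x_2)\in V[[x_0,x_2]]$ and integers $a_2,b_2,c_2\ge0$ such that $$f(x_0+x_2,x_2)=\frac{p_2(x_0,x_2)}{x_0^{a_2}(x_0+x_2)^{b_2}x_2^{c_2}}\quad\text{and}\quad h(x_2,x_0)=\frac{p_2(x_0,x_2)}{x_0^{a_2}(x_2+x_0)^{b_2}x_2^{c_2}}.$$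 (G) There exist $p_3(x_0,x_1)\in V[[x_0,x_1]]$ and integers $a_3,b_3,c_3\ge0$ such that $$g(-x_0+x_1,x_1)=\frac{p_3(x_0,x_1)}{x_0^{a_3}x_1^{b_3}(-x_0+x_1)^{c_3}}\quad\text{and}\quad h(x_1-x_0,x_0)=\frac{p_3(x_0,x_1)}{x_0^{a_3}x_1^{b_3}(x_1-x_0)^{c_3}}.$$ Then: (A) $\Rightarrow$ (B); (A) $\Rightarrow$ (C); (A) $\Rightarrow$ (D); (B) $\Rightarrow$ (E); (C) $\Rightarrow$ (F); (D) $\Rightarrow$ (G); (E) and (F) together imply (A); (E) and (G) together imply (A); (F) and (G) together imply (A).
   Context: All vector spaces are over $\mathbb C$; formal variables commute. For a vector space $U$, $U((x))$ is the space of formal Laurent series $\sum_{n\in\mathbb Z}u_nx^n$, $u_n\in U$, with $u_n=0$ for $n$ sufficiently negative; $U((x_1))((x_2))=(U((x_1)))((x_2))$; $U[[x,y]]$ is the space of formal power series. $\delta(x)=\sum_{n\in\mathbb Z}x^n$. Binomial expansion convention: for every $n\in\mathbb Z$ (positive or negative), $(x+y)^n=\sum_{k\ge0}\binom nk x^{n-k}y^k$, i.e. binomials are expanded in nonnegative powers of the second-listed variable (likewise with signs: $(x_1-x_2)^n$ is expanded in nonnegative powers of $x_2$, $(-x_2+x_1)^n$ in nonnegative powers of $x_1$, etc.). This applies inside $\delta$, to negative powers of binomials in denominators, and to substitutions such as $f(x_0+x_2,x_2)$, $g(-x_0+x_1,x_1)$ and $h(x_1-x_0,x_0)$. *)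

theory Defs
  imports Complex_Main
    "HOL-Computational_Algebra.Formal_Laurent_Series"
    "HOL-Library.Groups_Big_Fun"
begin

text \<open>
  All identities are read in the space of formal distributions
  \<open>V[[x\<^sub>0\<^sup>\<plusminus>, x\<^sub>1\<^sup>\<plusminus>, x\<^sub>2\<^sup>\<plusminus>]]\<close>, a distribution being its family of coefficients:
  \<open>u\<close> stands for the sum over \<open>e\<close> of \<open>u e\<close> times the monomial with exponent vector \<open>e\<close>.
  An expression involving only two of the variables is regarded as a distribution in all three
  that is supported on exponent \<open>0\<close> of the third.

  The vector space \<open>V\<close> is the type \<open>'v\<close> with a scalar multiplication \<open>sc\<close> by complex numbers.
  The space \<open>V((x\<^sub>1))((x\<^sub>2))\<close> is \<open>'v fls fls\<close>, and \<open>V[[x\<^sub>1,x\<^sub>2]]\<close> is \<open>'v fps fps\<close>; in both cases the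
  outer series is the one in the second variable.
\<close>

datatype var = X0 | X1 | X2

type_synonym 'a fdist = "(var \<Rightarrow> int) \<Rightarrow> 'a"

text \<open>
  Infinite sums of distributions are taken coefficientwise. \<^const>\<open>Sum_any\<close> is the sum of a family
  over a whole type and has the junk value \<open>0\<close> if infinitely many terms are nonzero; the lemmas
  below show that this does not happen for the sums used here.
\<close>

definition fmult :: "(complex \<Rightarrow> 'v \<Rightarrow> 'v) \<Rightarrow> complex fdist \<Rightarrow> 'v fdist \<Rightarrow> 'v::ab_group_add fdist"
  where "fmult sc c u = (\<lambda>e. Sum_any (\<lambda>d. sc (c d) (u (\<lambda>v. e v - d v))))"

abbreviation smult :: "complex fdist \<Rightarrow> complex fdist \<Rightarrow> complex fdist" (infixl \<open>\<star>\<close> 70)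
  where "c \<star> d \<equiv> fmult (*) c d"

definition xpow :: "var \<Rightarrow> int \<Rightarrow> complex fdist"
  where "xpow x n = (\<lambda>e. if e = (\<lambda>_. 0)(x := n) then 1 else 0)"

text \<open>
  \<open>binom_pow s x t y n\<close> is \<open>(s x + t y)\<^sup>n\<close> for \<open>s, t = \<plusminus>1\<close> and distinct variables \<open>x\<close>, \<open>y\<close>, expanded in
  nonnegative powers of the second-listed variable \<open>y\<close>.
\<close>

definition binom_pow :: "complex \<Rightarrow> var \<Rightarrow> complex \<Rightarrow> var \<Rightarrow> int \<Rightarrow> complex fdist"
  where "binom_pow s x t y n = (\<lambda>e.
    if 0 \<le> e y \<and> e = (\<lambda>_. 0)(x := n - e y, y := e y)
    then (of_int n gchoose nat (e y)) * s powi (n - e y) * t ^ nat (e y) else 0)"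

text \<open>\<open>delta s x t y z\<close> is \<open>\<delta>((s x + t y) / z)\<close>.\<close>

definition delta :: "complex \<Rightarrow> var \<Rightarrow> complex \<Rightarrow> var \<Rightarrow> var \<Rightarrow> complex fdist"
  where "delta s x t y z = (\<lambda>e. Sum_any (\<lambda>n. (binom_pow s x t y n \<star> xpow z (- n)) e))"

text \<open>\<open>emb f x y\<close> is \<open>f(x, y)\<close>, and \<open>fps_emb p x y\<close> is \<open>p(x, y)\<close>.\<close>

definition emb :: "'v::zero fls fls \<Rightarrow> var \<Rightarrow> var \<Rightarrow> 'v fdist"
  where "emb f x y = (\<lambda>e. if e = (\<lambda>_. 0)(x := e x, y := e y) then fls_nth (fls_nth f (e y)) (e x) else 0)"

definition fps_emb :: "'v::zero fps fps \<Rightarrow> var \<Rightarrow> var \<Rightarrow> 'v fdist"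
  where "fps_emb p x y = (\<lambda>e. if 0 \<le> e x \<and> 0 \<le> e y \<and> e = (\<lambda>_. 0)(x := e x, y := e y)
    then fps_nth (fps_nth p (nat (e y))) (nat (e x)) else 0)"

text \<open>\<open>subst sc f s x t y\<close> is \<open>f(s x + t y, y)\<close>.\<close>

definition subst :: "(complex \<Rightarrow> 'v \<Rightarrow> 'v) \<Rightarrow> 'v::ab_group_add fls fls \<Rightarrow>
    complex \<Rightarrow> var \<Rightarrow> complex \<Rightarrow> var \<Rightarrow> 'v fdist"
  where "subst sc f s x t y = (\<lambda>e. Sum_any (\<lambda>(m, n).
    sc ((binom_pow s x t y m \<star> xpow y n) e) (fls_nth (fls_nth f n) m)))"

text \<open>
  The following lemmas evaluate the products with monomials and the delta functions, and show that
  the remaining sums have finitely many nonzero terms.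
\<close>

lemma Sum_any_single:
  assumes "\<And>d. d \<noteq> a \<Longrightarrow> F d = 0"
  shows "Sum_any F = F a"
proof -
  have "Sum_any F = sum F {a}"
    by (rule Sum_any.expand_superset) (use assms in auto)
  then show ?thesis by simp
qed

lemma fmult_xpow:
  assumes "vector_space sc"
  shows "fmult sc (xpow z n) u e = u (e(z := e z - n))"
proof -
  interpret vector_space sc by fact
  have eq: "(\<lambda>v. e v - ((\<lambda>_. 0)(z := n)) v) = e(z := e z - n)"
    by (auto simp: fun_eq_iff)
  have "fmult sc (xpow z n) u e
      = sc (xpow z n ((\<lambda>_. 0)(z := n))) (u (\<lambda>v. e v - ((\<lambda>_. 0)(z := n)) v))"
    unfolding fmult_def by (rule Sum_any_single) (simp add: xpow_def)
  then show ?thesis unfolding eq by (simp add: xpow_def)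
qed

lemma smult_xpow: "(c \<star> xpow z n) e = c (e(z := e z - n))"
proof -
  have eq: "(\<lambda>v. e v - (e(z := e z - n)) v) = (\<lambda>_. 0)(z := n)"
    by (auto simp: fun_eq_iff)
  have "(c \<star> xpow z n) e = c (e(z := e z - n)) * xpow z n (\<lambda>v. e v - (e(z := e z - n)) v)"
    unfolding fmult_def
  proof (rule Sum_any_single)
    fix d assume d: "d \<noteq> e(z := e z - n)"
    have "(\<lambda>v. e v - d v) \<noteq> (\<lambda>_. 0)(z := n)"
    proof
      assume *: "(\<lambda>v. e v - d v) = (\<lambda>_. 0)(z := n)"
      have "d v = (e(z := e z - n)) v" for v
        using fun_cong[OF *, of v] by (auto split: if_splits)
      then show False using d by blast
    qed
    then show "c d * xpow z n (\<lambda>v. e v - d v) = 0" by (simp add: xpow_def)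
  qed
  then show ?thesis unfolding eq by (simp add: xpow_def)
qed

lemma binom_pow_nonzeroD:
  assumes "binom_pow s x t y n e \<noteq> 0" "x \<noteq> y"
  shows "0 \<le> e y" "e x = n - e y" "z \<noteq> x \<Longrightarrow> z \<noteq> y \<Longrightarrow> e z = 0"
    "0 \<le> n \<Longrightarrow> e y \<le> n"
proof -
  have *: "0 \<le> e y" "e = (\<lambda>_. 0)(x := n - e y, y := e y)"
      "(of_int n :: complex) gchoose nat (e y) \<noteq> 0"
    using assms by (auto simp: binom_pow_def split: if_splits)
  show "0 \<le> e y" by fact
  show "e x = n - e y" "z \<noteq> x \<Longrightarrow> z \<noteq> y \<Longrightarrow> e z = 0"
    using fun_cong[OF *(2), of x] fun_cong[OF *(2), of z] assms(2) by auto
  show "e y \<le> n" if "0 \<le> n"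
  proof (rule ccontr)
    assume "\<not> e y \<le> n"
    then have "nat n < nat (e y)" using that by linarith
    then have "(of_nat (nat n) :: complex) gchoose nat (e y) = 0"
      by (simp flip: binomial_gbinomial)
    then show False using *(3) that by simp
  qed
qed

lemma delta_eq:
  assumes "distinct [x, y, z]"
  shows "(xpow z (- 1) \<star> delta s x t y z) e = binom_pow s x t y (- e z - 1) (e(z := 0))"
proof -
  have vs: "vector_space ((*) :: complex \<Rightarrow> _)"
    by unfold_locales (auto simp: algebra_simps)
  let ?e = "e(z := e z + 1)"
  have "(xpow z (- 1) \<star> delta s x t y z) e = delta s x t y z ?e"
    by (simp add: fmult_xpow[OF vs])
  also have "\<dots> = Sum_any (\<lambda>n. binom_pow s x t y n (?e(z := ?e z + n)))"
    by (simp add: delta_def smult_xpow)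
  also have "\<dots> = binom_pow s x t y (- e z - 1) (?e(z := ?e z + (- e z - 1)))"
  proof (rule Sum_any_single, rule ccontr)
    fix n assume n: "n \<noteq> - e z - 1"
      and "binom_pow s x t y n (?e(z := ?e z + n)) \<noteq> 0"
    from binom_pow_nonzeroD(3)[OF this(2), of z] show False
      using n assms by auto
  qed
  finally show ?thesis by simp
qed

lemma var_cases: "distinct [x, y, z] \<Longrightarrow> v = x \<or> v = y \<or> v = (z :: var)"
  by (cases x; cases y; cases z; cases v) auto

lemma finite_by_exponent:
  fixes P :: "(var \<Rightarrow> int) \<Rightarrow> bool"
  assumes "\<And>d. P d \<Longrightarrow> A \<le> d y \<and> d y \<le> B"
    and "\<And>d d'. P d \<Longrightarrow> P d' \<Longrightarrow> d y = d' y \<Longrightarrow> d = d'"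
  shows "finite {d. P d}"
proof (rule finite_imageD)
  show "finite ((\<lambda>d. d y) ` {d. P d})"
    by (rule finite_subset[of _ "{A..B}"]) (use assms(1) in auto)
  show "inj_on (\<lambda>d. d y) {d. P d}"
    using assms(2) by (auto simp: inj_on_def)
qed

lemma fls_bounded_below: "\<exists>N. \<forall>n<N. fls_nth f n = 0"
  by (metis fls_eq0_below_subdegree)

lemma emb_bounded_below: "\<exists>N. \<forall>e. emb f x y e \<noteq> 0 \<longrightarrow> N \<le> e y"
proof -
  obtain N where N: "\<forall>n<N. fls_nth f n = 0" using fls_bounded_below by blast
  have "N \<le> e y" if "emb f x y e \<noteq> 0" for e
    using that N by (force simp: emb_def not_less[symmetric] split: if_splits)
  then show ?thesis by blast
qed

lemma finite_binom_pow_bounded_below: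
  assumes "vector_space sc" "x \<noteq> y" "\<And>e. u e \<noteq> 0 \<Longrightarrow> N \<le> e y"
  shows "finite {d. sc (binom_pow s x t y n d) (u (\<lambda>v. e v - d v)) \<noteq> 0}"
proof (rule finite_by_exponent[where y = y and A = 0 and B = "e y - N"])
  interpret vector_space sc by fact
  have nz: "binom_pow s x t y n d \<noteq> 0 \<and> u (\<lambda>v. e v - d v) \<noteq> 0"
    if "sc (binom_pow s x t y n d) (u (\<lambda>v. e v - d v)) \<noteq> 0" for d
    using that by auto
  {
    fix d assume d: "sc (binom_pow s x t y n d) (u (\<lambda>v. e v - d v)) \<noteq> 0"
    show "0 \<le> d y \<and> d y \<le> e y - N"
      using nz[OF d] binom_pow_nonzeroD(1)[of s x t y n d] assms(3)[of "\<lambda>v. e v - d v"] assms(2)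
      by auto
  }
  fix d d'
  assume d: "sc (binom_pow s x t y n d) (u (\<lambda>v. e v - d v)) \<noteq> 0"
    and d': "sc (binom_pow s x t y n d') (u (\<lambda>v. e v - d' v)) \<noteq> 0"
    and eq: "d y = d' y"
  show "d = d'"
  proof
    fix v
    show "d v = d' v"
      using binom_pow_nonzeroD(2)[OF conjunct1[OF nz[OF d]] assms(2)] binom_pow_nonzeroD(3)[OF conjunct1[OF nz[OF d]] assms(2), of v]
        binom_pow_nonzeroD(2)[OF conjunct1[OF nz[OF d']] assms(2)] binom_pow_nonzeroD(3)[OF conjunct1[OF nz[OF d']] assms(2), of v] eq
      by (cases "v = x"; cases "v = y") auto
  qed
qed

lemma finite_binom_pow_nonneg:
  assumes "vector_space sc" "x \<noteq> y" "0 \<le> n"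
  shows "finite {d. sc (binom_pow s x t y n d) (u (\<lambda>v. e v - d v)) \<noteq> 0}"
proof (rule finite_by_exponent[where y = y and A = 0 and B = n])
  interpret vector_space sc by fact
  have nz: "binom_pow s x t y n d \<noteq> 0"
    if "sc (binom_pow s x t y n d) (u (\<lambda>v. e v - d v)) \<noteq> 0" for d
    using that by auto
  {
    fix d assume d: "sc (binom_pow s x t y n d) (u (\<lambda>v. e v - d v)) \<noteq> 0"
    show "0 \<le> d y \<and> d y \<le> n"
      using binom_pow_nonzeroD(1,4)[OF nz[OF d] assms(2)] assms(3) by auto
  }
  fix d d'
  assume d: "sc (binom_pow s x t y n d) (u (\<lambda>v. e v - d v)) \<noteq> 0"
    and d': "sc (binom_pow s x t y n d') (u (\<lambda>v. e v - d' v)) \<noteq> 0"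
    and eq: "d y = d' y"
  show "d = d'"
  proof
    fix v
    show "d v = d' v"
      using binom_pow_nonzeroD(2)[OF nz[OF d] assms(2)] binom_pow_nonzeroD(3)[OF nz[OF d] assms(2), of v]
        binom_pow_nonzeroD(2)[OF nz[OF d'] assms(2)] binom_pow_nonzeroD(3)[OF nz[OF d'] assms(2), of v] eq
      by (cases "v = x"; cases "v = y") auto
  qed
qed

lemma finite_delta_emb:
  assumes "vector_space sc" "distinct [x, y, z]"
  shows "finite {d. sc ((xpow z (- 1) \<star> delta s x t y z) d) (emb f x y (\<lambda>v. e v - d v)) \<noteq> 0}"
proof -
  interpret vector_space sc by fact
  have xy: "x \<noteq> y" using assms(2) by simp
  obtain N where N: "\<And>e. emb f x y e \<noteq> 0 \<Longrightarrow> N \<le> e y"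
    using emb_bounded_below[of f x y] by blast
  define P where "P = (\<lambda>d. sc ((xpow z (- 1) \<star> delta s x t y z) d)
    (emb f x y (\<lambda>v. e v - d v)) \<noteq> 0)"
  have nz: "0 \<le> d y" "d y \<le> e y - N" "d z = e z" "d x = - e z - 1 - d y" if "P d" for d
  proof -
    have 1: "binom_pow s x t y (- d z - 1) (d(z := 0)) \<noteq> 0"
      and 2: "emb f x y (\<lambda>v. e v - d v) \<noteq> 0"
      using that by (auto simp: P_def delta_eq[OF assms(2)])
    show "0 \<le> d y" using binom_pow_nonzeroD(1)[OF 1 xy] assms(2) by auto
    show "d y \<le> e y - N" using N[OF 2] by simp
    have "(\<lambda>v. e v - d v) = (\<lambda>_. 0)(x := e x - d x, y := e y - d y)"
      using 2 by (auto simp: emb_def split: if_splits)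
    from fun_cong[OF this, of z] show z: "d z = e z" using assms(2) by auto
    show "d x = - e z - 1 - d y" using binom_pow_nonzeroD(2)[OF 1 xy] assms(2) z by auto
  qed
  have "finite {d. P d}"
  proof (rule finite_by_exponent[where y = y and A = 0 and B = "e y - N"])
    fix d d' assume d: "P d" and d': "P d'" and eq: "d y = d' y"
    show "d = d'"
    proof
      fix v show "d v = d' v"
        using var_cases[OF assms(2), of v] nz(3,4)[OF d] nz(3,4)[OF d'] eq by auto
    qed
  qed (use nz in auto)
  then show ?thesis by (simp add: P_def)
qed

lemma finite_subst:
  assumes "vector_space sc" "x \<noteq> y"
  shows "finite {(m, n). sc ((binom_pow s x t y m \<star> xpow y n) e) (fls_nth (fls_nth f n) m) \<noteq> 0}"
proof -
  interpret vector_space sc by fact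
  obtain N where N: "\<forall>n<N. fls_nth f n = 0" using fls_bounded_below by blast
  have "n \<in> {N..e y} \<and> m = e x + e y - n"
    if "sc ((binom_pow s x t y m \<star> xpow y n) e) (fls_nth (fls_nth f n) m) \<noteq> 0" for m n
  proof -
    have 1: "binom_pow s x t y m (e(y := e y - n)) \<noteq> 0" and 2: "fls_nth f n \<noteq> 0"
      using that by (auto simp: smult_xpow)
    show ?thesis
      using binom_pow_nonzeroD(1,2)[OF 1 assms(2)] 2 N assms(2) by (auto simp: not_less[symmetric])
  qed
  then have "{(m, n). sc ((binom_pow s x t y m \<star> xpow y n) e) (fls_nth (fls_nth f n) m) \<noteq> 0}
      \<subseteq> (\<lambda>n. (e x + e y - n, n)) ` {N..e y}"
    by force
  then show ?thesis by (rule finite_subset) simp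
qed

lemma finite_binom_pow_shift:
  assumes "vector_space sc" "x \<noteq> y" "\<And>e. u e \<noteq> 0 \<Longrightarrow> N \<le> e y"
  shows "finite {d. sc (binom_pow s x t y n (\<lambda>v. d v - r v)) (u (\<lambda>v. e v - d v)) \<noteq> 0}"
proof -
  let ?S = "{d. sc (binom_pow s x t y n d) (u (\<lambda>v. (e v - r v) - d v)) \<noteq> 0}"
  have "finite ?S"
    using finite_binom_pow_bounded_below[OF assms(1,2), of u N s t n "\<lambda>v. e v - r v"] assms(3)
    by simp
  then have "finite ((\<lambda>d v. d v + r v) ` ?S)" by simp
  moreover have "d \<in> (\<lambda>d v. d v + r v) ` ?S"
    if "sc (binom_pow s x t y n (\<lambda>v. d v - r v)) (u (\<lambda>v. e v - d v)) \<noteq> 0" for d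
    by (rule image_eqI[of _ _ "\<lambda>v. d v - r v"]) (use that in auto)
  ultimately show ?thesis by (rule finite_subset[OF subsetI, rotated]) simp
qed

lemma finite_quotient:
  assumes "vector_space sc" "x \<noteq> y" "y \<in> {x', y'}"
    and c: "c \<in> {binom_pow s x t y n \<star> xpow v k \<star> xpow w l,
      xpow v k \<star> binom_pow s x t y n \<star> xpow w l, xpow v k \<star> xpow w l \<star> binom_pow s x t y n}"
  shows "finite {d. sc (c d) (fps_emb p x' y' (\<lambda>v. e v - d v)) \<noteq> 0}"
proof -
  define r where "r = (\<lambda>u. (if u = v then k else 0) + (if u = w then l else 0))"
  have vs: "vector_space ((*) :: complex \<Rightarrow> _)"
    by unfold_locales (auto simp: algebra_simps)
  have xx: "xpow v k \<star> xpow w l = (\<lambda>d. if d = r then 1 else 0)"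
  proof
    fix d :: "var \<Rightarrow> int"
    have "d(v := d v - k) = (\<lambda>_. 0)(w := l) \<longleftrightarrow> d = r"
    proof
      assume *: "d(v := d v - k) = (\<lambda>_. 0)(w := l)"
      show "d = r"
      proof
        fix u show "d u = r u"
          using fun_cong[OF *, of u] by (auto simp: r_def split: if_splits)
      qed
    qed (auto simp: r_def fun_eq_iff)
    then show "(xpow v k \<star> xpow w l) d = (if d = r then 1 else 0)"
      unfolding fmult_xpow[OF vs] by (simp add: xpow_def)
  qed
  have "c d = binom_pow s x t y n (\<lambda>v. d v - r v)" for d
  proof -
    have sh: "(d(w := d w - l))(v := (d(w := d w - l)) v - k) = (\<lambda>v. d v - r v)"
      by (auto simp: r_def fun_eq_iff)
    have 1: "(binom_pow s x t y n \<star> xpow v k \<star> xpow w l) d = binom_pow s x t y n (\<lambda>v. d v - r v)"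
      by (simp only: smult_xpow sh)
    have 2: "(xpow v k \<star> binom_pow s x t y n \<star> xpow w l) d = binom_pow s x t y n (\<lambda>v. d v - r v)"
      by (simp only: smult_xpow fmult_xpow[OF vs] sh)
    have "(xpow v k \<star> xpow w l \<star> binom_pow s x t y n) d
        = (xpow v k \<star> xpow w l) r * binom_pow s x t y n (\<lambda>v. d v - r v)"
      unfolding xx unfolding fmult_def by (subst Sum_any_single[of r]) auto
    then have 3: "(xpow v k \<star> xpow w l \<star> binom_pow s x t y n) d
        = binom_pow s x t y n (\<lambda>v. d v - r v)"
      unfolding xx by simp
    show ?thesis using c 1 2 3 by auto
  qed
  moreover have "0 \<le> e y" if "fps_emb p x' y' e \<noteq> 0" for e
    using that assms(3) by (auto simp: fps_emb_def split: if_splits)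
  ultimately show ?thesis
    using finite_binom_pow_shift[OF assms(1,2), of "fps_emb p x' y'" 0] by simp
qed

definition statement_A where
  "statement_A sc f g h \<longleftrightarrow>
    fmult sc (xpow X0 (- 1) \<star> delta 1 X1 (- 1) X2 X0) (emb f X1 X2)
    - fmult sc (xpow X0 (- 1) \<star> delta (- 1) X2 1 X1 X0) (emb g X2 X1)
    - fmult sc (xpow X1 (- 1) \<star> delta 1 X2 1 X0 X1) (emb h X2 X0) = (\<lambda>_. 0)"

definition statement_B where
  "statement_B sc f g \<longleftrightarrow> (\<exists>m::nat.
    fmult sc (binom_pow 1 X1 (- 1) X2 (int m)) (emb f X1 X2 - emb g X2 X1) = (\<lambda>_. 0))"

definition statement_C where
  "statement_C sc f h \<longleftrightarrow> (\<exists>m::nat.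
    fmult sc (binom_pow 1 X0 1 X2 (int m)) (subst sc f 1 X0 1 X2 - emb h X2 X0) = (\<lambda>_. 0))"

definition statement_D where
  "statement_D sc g h \<longleftrightarrow> (\<exists>m::nat.
    fmult sc (binom_pow 1 X1 (- 1) X0 (int m))
      (subst sc g (- 1) X0 1 X1 - subst sc h 1 X1 (- 1) X0) = (\<lambda>_. 0))"

definition statement_E where
  "statement_E sc f g \<longleftrightarrow> (\<exists>(p :: 'v::ab_group_add fps fps) (a::nat) (b::nat) (c::nat).
    emb f X1 X2 = fmult sc
      (binom_pow 1 X1 (- 1) X2 (- int a) \<star> xpow X1 (- int b) \<star> xpow X2 (- int c))
      (fps_emb p X1 X2) \<and>
    emb g X2 X1 = fmult sc
      (binom_pow (- 1) X2 1 X1 (- int a) \<star> xpow X1 (- int b) \<star> xpow X2 (- int c))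
      (fps_emb p X1 X2))"

definition statement_F where
  "statement_F sc f h \<longleftrightarrow> (\<exists>(p :: 'v::ab_group_add fps fps) (a::nat) (b::nat) (c::nat).
    subst sc f 1 X0 1 X2 = fmult sc
      (xpow X0 (- int a) \<star> binom_pow 1 X0 1 X2 (- int b) \<star> xpow X2 (- int c))
      (fps_emb p X0 X2) \<and>
    emb h X2 X0 = fmult sc
      (xpow X0 (- int a) \<star> binom_pow 1 X2 1 X0 (- int b) \<star> xpow X2 (- int c))
      (fps_emb p X0 X2))"

definition statement_G where
  "statement_G sc g h \<longleftrightarrow> (\<exists>(p :: 'v::ab_group_add fps fps) (a::nat) (b::nat) (c::nat).
    subst sc g (- 1) X0 1 X1 = fmult sc
      (xpow X0 (- int a) \<star> xpow X1 (- int b) \<star> binom_pow (- 1) X0 1 X1 (- int c))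
      (fps_emb p X0 X1) \<and>
    subst sc h 1 X1 (- 1) X0 = fmult sc
      (xpow X0 (- int a) \<star> xpow X1 (- int b) \<star> binom_pow 1 X1 (- 1) X0 (- int c))
      (fps_emb p X0 X1))"

end

theory Submission
  imports Defs
begin

text \<open>
  The three terms of (A), call them \<open>F\<close>, \<open>G\<close> and \<open>H\<close>, all lie in the kernel \<open>K\<close> of
  multiplication by \<open>x\<^sub>0 - x\<^sub>1 + x\<^sub>2\<close>, because \<open>z\<^sup>-\<^sup>1 \<delta>(w / z)\<close> is killed by \<open>z - w\<close>. What distinguishes
  them is the direction of expansion: the exponents of \<open>x\<^sub>2\<close> in \<open>F\<close>, of \<open>x\<^sub>1\<close> in \<open>G\<close> and of \<open>x\<^sub>0\<close> in \<open>H\<close>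
  are bounded below. (A) says \<open>F - G - H = 0\<close>.
  
  An element \<open>T\<close> of \<open>K\<close> is controlled by its residue in any one of the variables. For \<open>x\<^sub>0\<close>, say, the
  relation \<open>x\<^sub>0 T = (x\<^sub>1 - x\<^sub>2) T\<close> turns the coefficient of \<open>x\<^sub>0\<^sup>-\<^sup>1\<^sup>-\<^sup>m\<close> into \<open>(x\<^sub>1 - x\<^sub>2)\<^sup>m\<close> times the residue
  \<open>Res\<^bsub>x\<^sub>0\<^esub> T\<close>, so \<open>T\<close> is bounded below in \<open>x\<^sub>0\<close> iff some power of \<open>x\<^sub>1 - x\<^sub>2\<close> kills that residue
  (\<open>formal_res_annihilated_iff\<close>). The residues of \<open>F\<close>, \<open>G\<close>, \<open>H\<close> are, up to sign, the series that
  occur in (B), (C), (D) (\<open>formal_res_terms\<close>). Hence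
  
    \<^item> (B) holds iff \<open>F - G\<close> is bounded below in \<open>x\<^sub>0\<close>;
    \<^item> (C) holds iff \<open>F - H\<close> is bounded below in \<open>x\<^sub>1\<close>;
    \<^item> (D) holds iff \<open>G + H\<close> is bounded below in \<open>x\<^sub>2\<close>.
  
  If (A) holds, these combinations are \<open>H\<close>, \<open>G\<close> and \<open>F\<close>, so (B), (C), (D) follow. Conversely, if two of
  (B), (C), (D) hold, then \<open>F - G - H\<close> is an element of \<open>K\<close> that is bounded below in two variables,
  and only \<open>0\<close> has this property (\<open>in_kernel_zero\<close>).
  
  Finally (B), (C), (D) are equivalent to (E), (F), (G) respectively, by one and the same argument
  (\<open>common_quotient_iff\<close>). If \<open>(s x + t y)\<^sup>m\<close> kills \<open>u - w\<close>, where \<open>u\<close> is bounded below in \<open>y\<close> and \<open>w\<close> in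
  \<open>x\<close>, then \<open>(s x + t y)\<^sup>m u = (s x + t y)\<^sup>m w\<close> is bounded below in both variables, that is, a power series
  times a monomial; multiplying back by the two expansions of \<open>(s x + t y)\<^sup>-\<^sup>m\<close> gives \<open>u\<close> and \<open>w\<close>.
\<close>

section \<open>Distributions bounded below in a variable\<close>

lemma Sum_any_reindex_inj:
  assumes "inj \<phi>" and "\<And>d. F d \<noteq> 0 \<Longrightarrow> d \<in> range \<phi>"
  shows "Sum_any F = Sum_any (\<lambda>k. F (\<phi> k))"
proof -
  have "{d. F d \<noteq> 0} = \<phi> ` {k. F (\<phi> k) \<noteq> 0}" using assms(2) by fastforce
  moreover have "inj_on \<phi> {k. F (\<phi> k) \<noteq> 0}" using assms(1) by (rule inj_on_subset) simp
  ultimately show ?thesis by (simp add: Sum_any.expand_set sum.reindex o_def)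
qed

definition bdd_below_in :: "var \<Rightarrow> 'v::zero fdist \<Rightarrow> bool"
  where "bdd_below_in v u \<longleftrightarrow> (\<exists>N. \<forall>e. u e \<noteq> 0 \<longrightarrow> N \<le> e v)"

lemma bdd_below_inI: "(\<And>e. e v < N \<Longrightarrow> u e = 0) \<Longrightarrow> bdd_below_in v u"
  unfolding bdd_below_in_def by (meson linorder_not_less)

lemma bdd_below_inE:
  assumes "bdd_below_in v u"
  obtains N where "\<And>e. e v < N \<Longrightarrow> u e = 0"
  using assms unfolding bdd_below_in_def by (meson linorder_not_less)

lemma bdd_below_in_combine:
  assumes "bdd_below_in v u" "bdd_below_in v w" "\<And>e. u e = 0 \<Longrightarrow> w e = 0 \<Longrightarrow> r e = 0"
  shows "bdd_below_in v r"
proof -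
  obtain M N where "\<And>e. e v < M \<Longrightarrow> u e = 0" "\<And>e. e v < N \<Longrightarrow> w e = 0"
    using assms(1,2) by (elim bdd_below_inE) blast
  then show ?thesis by (intro bdd_below_inI[of v "min M N"] assms(3)) auto
qed

lemma bdd_below_in_shift:
  assumes "bdd_below_in v u"
  shows "bdd_below_in v (\<lambda>e. u (e(w := e w - k)))"
proof -
  obtain N where "\<And>e. e v < N \<Longrightarrow> u e = 0" using assms by (elim bdd_below_inE) blast
  then show ?thesis by (intro bdd_below_inI[of v "min N (N + k)"]) (cases "v = w"; simp)
qed

lemma bdd_below_in_emb: "bdd_below_in y (emb f x y)"
  unfolding bdd_below_in_def by (rule emb_bounded_below)

text \<open>
  A distribution in the two variables other than \<open>z\<close> is one in all three that is supported on exponent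
  \<open>0\<close> of \<open>z\<close>.
\<close>
definition free_of :: "var \<Rightarrow> 'v::zero fdist \<Rightarrow> bool"
  where "free_of z u \<longleftrightarrow> (\<forall>e. u e \<noteq> 0 \<longrightarrow> e z = 0)"

section \<open>Coefficients in terms of the three exponents\<close>
lemma emb_eq:
  assumes "distinct [x, y, z]"
  shows "emb f x y e = (if e z = 0 then fls_nth (fls_nth f (e y)) (e x) else 0)"
proof -
  have "e = (\<lambda>_. 0)(x := e x, y := e y) \<longleftrightarrow> e z = 0"
    using assms var_cases[OF assms] by (auto simp: fun_eq_iff)
  then show ?thesis by (simp add: emb_def)
qed

lemma fps_emb_eq:
  assumes "distinct [x, y, z]"
  shows "fps_emb p x y e = (if 0 \<le> e x \<and> 0 \<le> e y \<and> e z = 0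
    then fps_nth (fps_nth p (nat (e y))) (nat (e x)) else 0)"
proof -
  have "e = (\<lambda>_. 0)(x := e x, y := e y) \<longleftrightarrow> e z = 0"
    using assms var_cases[OF assms] by (auto simp: fun_eq_iff)
  then show ?thesis by (simp add: fps_emb_def)
qed

lemma binom_pow_eq:
  assumes "distinct [x, y, z]"
  shows "binom_pow s x t y n e = (if 0 \<le> e y \<and> e x = n - e y \<and> e z = 0
    then (of_int n gchoose nat (e y)) * s powi (n - e y) * t ^ nat (e y) else 0)"
proof -
  have "e = (\<lambda>_. 0)(x := n - e y, y := e y) \<longleftrightarrow> e x = n - e y \<and> e z = 0"
    using assms var_cases[OF assms] by (auto simp: fun_eq_iff)
  then show ?thesis by (simp add: binom_pow_def)
qed

lemma distinct_vars:
  "distinct [x, y, z] \<Longrightarrow> x \<noteq> y \<and> y \<noteq> x \<and> x \<noteq> z \<and> z \<noteq> x \<and> y \<noteq> z \<and> z \<noteq> y"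
  by auto

lemma third_var: "x \<noteq> y \<Longrightarrow> \<exists>z. distinct [x, y, z :: var]"
  by (rule exI[of _ "if X0 \<notin> {x, y} then X0 else if X1 \<notin> {x, y} then X1 else X2"])
    (cases x; cases y; simp)

text \<open>
  Pascal's rule: \<open>(s x + t y)\<^sup>n\<^sup>+\<^sup>1 = (s x + t y) (s x + t y)\<^sup>n\<close>, also for negative \<open>n\<close>. The scalar \<open>s\<close> must
  be invertible because it occurs with negative exponents.
\<close>
lemma binom_pow_Suc:
  assumes "x \<noteq> y" "s \<noteq> 0"
  shows "binom_pow s x t y (n + 1) e = s * binom_pow s x t y n (e(x := e x - 1))
    + t * binom_pow s x t y n (e(y := e y - 1))"
proof -
  obtain z where d: "distinct [x, y, z]" using third_var[OF assms(1)] by blast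
  have upd: "(e(x := a)) x = a" "(e(x := a)) y = e y" "(e(x := a)) z = e z"
    "(e(y := a)) x = e x" "(e(y := a)) y = a" "(e(y := a)) z = e z" for a
    using d by auto
  have xe: "binom_pow s x t y n (e(x := e x - 1)) = (if 0 \<le> e y \<and> e x = n + 1 - e y \<and> e z = 0
      then (of_int n gchoose nat (e y)) * s powi (n - e y) * t ^ nat (e y) else 0)"
    and ye: "binom_pow s x t y n (e(y := e y - 1)) = (if 1 \<le> e y \<and> e x = n + 1 - e y \<and> e z = 0
      then (of_int n gchoose nat (e y - 1)) * s powi (n - (e y - 1)) * t ^ nat (e y - 1) else 0)"
    unfolding binom_pow_eq[OF d] upd by (rule if_cong; auto)+
  show ?thesis
  proof (cases "0 \<le> e y \<and> e x = n + 1 - e y \<and> e z = 0")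
    case False
    then have "\<not> (1 \<le> e y \<and> e x = n + 1 - e y \<and> e z = 0)" by linarith
    then show ?thesis using False
      by (simp only: xe ye binom_pow_eq[OF d, of s t "n + 1" e] if_False simp_thms mult_zero_right add_0)
  next
    case True
    then obtain k where k: "e y = int k" by (metis nonneg_int_cases)
    have e: "e x = n + 1 - e y" "e z = 0" using True by auto
    have l: "binom_pow s x t y (n + 1) e = (of_int n + 1 gchoose k) * s powi (n + 1 - int k) * t ^ k"
      by (simp only: binom_pow_eq[OF d, of s t "n + 1" e] e k) simp
    have r1: "binom_pow s x t y n (e(x := e x - 1)) = (of_int n gchoose k) * s powi (n - int k) * t ^ k"
      by (subst xe) (simp add: e k)
    have p: "s powi (n + 1 - int k) = s * s powi (n - int k)"
      using assms(2) power_int_add[of s "n - int k" 1] by (simp add: algebra_simps)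
    show ?thesis
    proof (cases k)
      case 0
      have "binom_pow s x t y n (e(y := e y - 1)) = 0" by (subst ye) (simp add: e k 0)
      then show ?thesis unfolding l r1 p by (simp add: 0)
    next
      case (Suc j)
      have r2: "binom_pow s x t y n (e(y := e y - 1)) = (of_int n gchoose j) * (s * s powi (n - int k)) * t ^ j"
        unfolding p[symmetric] by (subst ye) (simp add: e k Suc)
      have "(of_int n + 1 :: complex) gchoose k = (of_int n gchoose j) + (of_int n gchoose k)"
        unfolding Suc by (rule gbinomial_Suc_Suc)
      then show ?thesis unfolding l r1 r2 p by (simp add: Suc ring_distribs)
    qed
  qed
qed

section \<open>The action of powers of a binomial\<close>
locale complex_vector_space = vector_space sc
  for sc :: "complex \<Rightarrow> 'v::ab_group_add \<Rightarrow> 'v"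
begin

text \<open>
  Multiplication by \<open>s x + t y\<close>. It is defined on all distributions, whereas negative powers of
  \<open>s x + t y\<close> act only on those that are bounded below in the variable of expansion.
\<close>
definition mult_lin :: "complex \<Rightarrow> var \<Rightarrow> complex \<Rightarrow> var \<Rightarrow> 'v fdist \<Rightarrow> 'v fdist"
  where "mult_lin s x t y u = (\<lambda>e. sc s (u (e(x := e x - 1))) + sc t (u (e(y := e y - 1))))"

lemma mult_lin_commute: "mult_lin s x t y = mult_lin t y s x"
  by (simp add: mult_lin_def fun_eq_iff add.commute)

lemma mult_lin_diff: "mult_lin s x t y (\<lambda>e. u e - w e) e = mult_lin s x t y u e - mult_lin s x t y w e"
  by (simp add: mult_lin_def scale_right_diff_distrib)

text \<open>
  The terms of \<open>u\<close> of lowest degree in \<open>y\<close> contribute \<open>s x\<close> times themselves to the product, and no term of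
  \<open>t y u\<close> has so low a degree in \<open>y\<close>. On unbounded distributions the claim fails, \<open>\<delta>(x / y)\<close> being killed by \<open>x - y\<close>.
\<close>
lemma mult_lin_eq_0D:
  assumes "x \<noteq> y" "s \<noteq> 0" "bdd_below_in y u" "\<And>e. mult_lin s x t y u e = 0"
  shows "u e = 0"
proof -
  obtain N where N: "\<And>e. e y < N \<Longrightarrow> u e = 0" using assms(3) by (elim bdd_below_inE) blast
  have "u e = 0" if "e y < N + int j" for j e
    using that
  proof (induction j arbitrary: e)
    case 0
    then show ?case using N by simp
  next
    case (Suc j)
    \<comment> \<open>At the exponent \<open>?e\<close> the product \<open>(s x + t y) u\<close> involves \<open>u e\<close> and one coefficient of lower degree in \<open>y\<close>.\<close>
    let ?e = "e(x := e x + 1)"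
    have "u (?e(y := ?e y - 1)) = 0" by (rule Suc.IH) (use Suc.prems assms(1) in auto)
    then show ?case using assms(1,2) assms(4)[of ?e] by (auto simp: mult_lin_def)
  qed
  from this[of e "nat (e y - N + 1)"] show ?thesis by simp
qed

lemma fmult_shift_left:
  "Sum_any (\<lambda>d. sc (c (d(v := d v - k))) (u (\<lambda>w. e w - d w))) = fmult sc c u (e(v := e v - k))"
proof -
  have "Sum_any (\<lambda>d. sc (c (d(v := d v - k))) (u (\<lambda>w. e w - d w)))
      = Sum_any (\<lambda>d. sc (c ((d(v := d v + k))(v := (d(v := d v + k)) v - k)))
          (u (\<lambda>w. e w - (d(v := d v + k)) w)))"
  proof (rule Sum_any_reindex_inj)
    show "inj (\<lambda>d. d(v := d v + k))"
    proof (rule injI)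
      fix d d' :: "var \<Rightarrow> int" assume eq: "d(v := d v + k) = d'(v := d' v + k)"
      show "d = d'" using fun_cong[OF eq] by (metis add_right_cancel ext fun_upd_apply)
    qed
    show "d \<in> range (\<lambda>d. d(v := d v + k))" for d :: "var \<Rightarrow> int"
      by (rule range_eqI[of _ _ "d(v := d v - k)"]) simp
  qed
  also have "\<dots> = fmult sc c u (e(v := e v - k))"
    unfolding fmult_def
    by (intro arg_cong[where f = Sum_any] ext arg_cong2[where f = sc] arg_cong[where f = u])
      (auto simp: fun_eq_iff)
  finally show ?thesis .
qed

text \<open>
  One of the two alternatives is needed to make the sums finite: for \<open>n < 0\<close> and unbounded \<open>u\<close>
  infinitely many terms can be nonzero.
\<close>
lemma fmult_binom_pow_Suc:
  assumes "x \<noteq> y" "s \<noteq> 0" "bdd_below_in y u \<or> 0 \<le> n"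
  shows "fmult sc (binom_pow s x t y (n + 1)) u = mult_lin s x t y (fmult sc (binom_pow s x t y n) u)"
proof
  fix e
  let ?c = "binom_pow s x t y n"
  have fin: "finite {d. sc (?c d) (u (\<lambda>v. e v - d v)) \<noteq> 0}" for e
    using assms(3) finite_binom_pow_nonneg[OF vector_space_axioms assms(1), of n s t u e]
      finite_binom_pow_bounded_below[OF vector_space_axioms assms(1), of u _ s t n e]
    unfolding bdd_below_in_def by blast
  have fin': "finite {d. sc (?c (d(v := d v - 1))) (u (\<lambda>w. e w - d w)) \<noteq> 0}" for v
  proof (rule finite_subset)
    show "finite ((\<lambda>d. d(v := d v + 1)) ` {d. sc (?c d) (u (\<lambda>w. (e(v := e v - 1)) w - d w)) \<noteq> 0})"
      by (intro finite_imageI fin)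
    show "{d. sc (?c (d(v := d v - 1))) (u (\<lambda>w. e w - d w)) \<noteq> 0} \<subseteq>
      (\<lambda>d. d(v := d v + 1)) ` {d. sc (?c d) (u (\<lambda>w. (e(v := e v - 1)) w - d w)) \<noteq> 0}"
    proof
      fix d assume d: "d \<in> {d. sc (?c (d(v := d v - 1))) (u (\<lambda>w. e w - d w)) \<noteq> 0}"
      have "(\<lambda>w. (e(v := e v - 1)) w - (d(v := d v - 1)) w) = (\<lambda>w. e w - d w)" by auto
      then show "d \<in> (\<lambda>d. d(v := d v + 1)) ` {d. sc (?c d) (u (\<lambda>w. (e(v := e v - 1)) w - d w)) \<noteq> 0}"
        using d by (intro image_eqI[of _ _ "d(v := d v - 1)"]) auto
    qed
  qed
  have scal: "Sum_any (\<lambda>d. sc r (sc (?c (d(v := d v - 1))) (u (\<lambda>w. e w - d w))))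
      = sc r (fmult sc ?c u (e(v := e v - 1)))"
    and fin'': "finite {d. sc r (sc (?c (d(v := d v - 1))) (u (\<lambda>w. e w - d w))) \<noteq> 0}" for r v
  proof -
    show f2: "finite {d. sc r (sc (?c (d(v := d v - 1))) (u (\<lambda>w. e w - d w))) \<noteq> 0}"
      by (rule finite_subset[OF _ fin'[of v]]) auto
    have "Sum_any (\<lambda>d. sc r (sc (?c (d(v := d v - 1))) (u (\<lambda>w. e w - d w))))
      = (\<Sum>d | sc (?c (d(v := d v - 1))) (u (\<lambda>w. e w - d w)) \<noteq> 0.
            sc r (sc (?c (d(v := d v - 1))) (u (\<lambda>w. e w - d w))))"
      by (rule Sum_any.expand_superset) (use fin' in auto)
    also have "\<dots> = sc r (Sum_any (\<lambda>d. sc (?c (d(v := d v - 1))) (u (\<lambda>w. e w - d w))))"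
      by (simp add: Sum_any.expand_set scale_sum_right)
    finally show "Sum_any (\<lambda>d. sc r (sc (?c (d(v := d v - 1))) (u (\<lambda>w. e w - d w))))
      = sc r (fmult sc ?c u (e(v := e v - 1)))"
      unfolding fmult_shift_left .
  qed
  have "fmult sc (binom_pow s x t y (n + 1)) u e
      = Sum_any (\<lambda>d. sc s (sc (?c (d(x := d x - 1))) (u (\<lambda>w. e w - d w)))
          + sc t (sc (?c (d(y := d y - 1))) (u (\<lambda>w. e w - d w))))"
    unfolding fmult_def
    by (simp add: binom_pow_Suc[OF assms(1,2)] scale_left_distrib)
  also have "\<dots> = Sum_any (\<lambda>d. sc s (sc (?c (d(x := d x - 1))) (u (\<lambda>w. e w - d w))))
      + Sum_any (\<lambda>d. sc t (sc (?c (d(y := d y - 1))) (u (\<lambda>w. e w - d w))))"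
    by (rule Sum_any.distrib[OF fin'' fin''])
  also have "\<dots> = mult_lin s x t y (fmult sc ?c u) e"
    by (simp only: scal mult_lin_def)
  finally show "fmult sc (binom_pow s x t y (n + 1)) u e = mult_lin s x t y (fmult sc ?c u) e" .
qed

text \<open>
  The support of \<open>(s x + t y)\<^sup>n\<close> is a half-line, so the product is a sum over the exponent of \<open>y\<close> alone.
\<close>
lemma fmult_binom_pow_sum:
  assumes "distinct [x, y, z]"
  shows "fmult sc (binom_pow s x t y n) u e = Sum_any (\<lambda>k::nat.
    sc ((of_int n gchoose k) * s powi (n - int k) * t ^ k)
      (u (e(x := e x - (n - int k), y := e y - int k))))"
proof -
  let ?\<phi> = "\<lambda>k::nat. ((\<lambda>_. 0)(x := n - int k, y := int k)) :: var \<Rightarrow> int"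
  have "fmult sc (binom_pow s x t y n) u e
      = Sum_any (\<lambda>k. sc (binom_pow s x t y n (?\<phi> k)) (u (\<lambda>v. e v - ?\<phi> k v)))"
    unfolding fmult_def
  proof (rule Sum_any_reindex_inj)
    show "inj ?\<phi>" by (rule injI) (metis fun_upd_same of_nat_eq_iff)
    fix d assume "sc (binom_pow s x t y n d) (u (\<lambda>v. e v - d v)) \<noteq> 0"
    then have "binom_pow s x t y n d \<noteq> 0" by auto
    then have "0 \<le> d y \<and> d = (\<lambda>_. 0)(x := n - d y, y := d y)"
      by (auto simp: binom_pow_def split: if_splits)
    then show "d \<in> range ?\<phi>" by (intro range_eqI[of _ _ "nat (d y)"]) simp
  qed
  moreover have "(\<lambda>v. e v - ?\<phi> k v) = e(x := e x - (n - int k), y := e y - int k)" for k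
    using assms by auto
  moreover have "binom_pow s x t y n (?\<phi> k) = (of_int n gchoose k) * s powi (n - int k) * t ^ k" for k
    using distinct_vars[OF assms] by (simp add: binom_pow_eq[OF assms])
  ultimately show ?thesis by simp
qed

lemma fmult_binom_pow_0:
  assumes "x \<noteq> y"
  shows "fmult sc (binom_pow s x t y 0) u = u"
proof
  fix e
  obtain z where d: "distinct [x, y, z]" using third_var[OF assms] by blast
  have "fmult sc (binom_pow s x t y 0) u e = sc ((of_int 0 gchoose 0) * s powi (0 - int 0) * t ^ 0)
      (u (e(x := e x - (0 - int 0), y := e y - int 0)))"
    unfolding fmult_binom_pow_sum[OF d]
    by (rule Sum_any_single) (auto simp: gbinomial_0_left)
  then show "fmult sc (binom_pow s x t y 0) u e = u e" by simp
qed

lemma bdd_below_in_fmult_binom_pow: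
  assumes "x \<noteq> y" "bdd_below_in y u"
  shows "bdd_below_in y (fmult sc (binom_pow s x t y n) u)"
proof -
  obtain z where d: "distinct [x, y, z]" using third_var[OF assms(1)] by blast
  obtain N where N: "\<And>e. e y < N \<Longrightarrow> u e = 0" using assms(2) by (elim bdd_below_inE) blast
  have "u (e(x := a, y := e y - int k)) = 0" if "e y < N" for e a k
    by (rule N) (use that in auto)
  then show ?thesis by (intro bdd_below_inI[of y N]) (simp add: fmult_binom_pow_sum[OF d])
qed

text \<open>
  Increasing \<open>m\<close> multiplies both sides by \<open>s x + t y\<close>. Decreasing \<open>m\<close> is possible because this
  multiplication is injective on distributions that are bounded below in \<open>y\<close>. In particular the powers \<open>m\<close>
  and \<open>- m\<close> act inversely to each other.
\<close>
lemma fmult_binom_pow_add: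
  assumes "x \<noteq> y" "s \<noteq> 0" "bdd_below_in y u"
  shows "fmult sc (binom_pow s x t y m) (fmult sc (binom_pow s x t y n) u)
    = fmult sc (binom_pow s x t y (m + n)) u"
proof (induction m rule: int_induct[of _ 0])
  case base
  show ?case by (simp add: fmult_binom_pow_0[OF assms(1)])
next
  case (step1 i)
  have "bdd_below_in y (fmult sc (binom_pow s x t y n) u)"
    by (rule bdd_below_in_fmult_binom_pow) fact+
  then show ?case
    using step1 fmult_binom_pow_Suc[of x y s "fmult sc (binom_pow s x t y n) u" i]
      fmult_binom_pow_Suc[of x y s u "i + n"] assms by (simp add: ac_simps)
next
  case (step2 i)
  let ?w = "fmult sc (binom_pow s x t y n) u"
  let ?D = "\<lambda>e. fmult sc (binom_pow s x t y (i - 1)) ?w e - fmult sc (binom_pow s x t y (i - 1 + n)) u e"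
  have b: "bdd_below_in y ?w" by (rule bdd_below_in_fmult_binom_pow) fact+
  have bD: "bdd_below_in y ?D"
    by (rule bdd_below_in_combine[OF bdd_below_in_fmult_binom_pow[OF assms(1) b, of s t "i - 1"]
          bdd_below_in_fmult_binom_pow[OF assms(1,3), of s t "i - 1 + n"]]) simp
  have "mult_lin s x t y ?D e = 0" for e
    using fmult_binom_pow_Suc[of x y s ?w "i - 1"] fmult_binom_pow_Suc[of x y s u "i - 1 + n"]
      step2 assms b by (simp add: mult_lin_diff algebra_simps)
  then have "?D e = 0" for e
    by (rule mult_lin_eq_0D[OF assms(1,2) bD])
  then show ?case by (simp add: fun_eq_iff)
qed

text \<open>
  For a nonnegative power the direction of expansion does not matter: the right-hand side is symmetric by
  \<open>mult_lin_commute\<close>.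
\<close>
lemma fmult_binom_pow_nat:
  assumes "x \<noteq> y" "s \<noteq> 0"
  shows "fmult sc (binom_pow s x t y (int m)) u = (mult_lin s x t y ^^ m) u"
proof (induction m)
  case 0
  show ?case by (simp add: fmult_binom_pow_0[OF assms(1)])
next
  case (Suc m)
  then show ?case using fmult_binom_pow_Suc[OF assms, of u "int m"] by (simp add: add.commute)
qed

lemma mult_lin_funpow_diff:
  "(mult_lin s x t y ^^ m) (\<lambda>e. u e - w e) e = (mult_lin s x t y ^^ m) u e - (mult_lin s x t y ^^ m) w e"
proof (induction m arbitrary: e)
  case (Suc m)
  have "(mult_lin s x t y ^^ m) (\<lambda>e. u e - w e)
      = (\<lambda>e. (mult_lin s x t y ^^ m) u e - (mult_lin s x t y ^^ m) w e)"
    using Suc by blast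
  then show ?case by (simp add: mult_lin_diff)
qed simp

lemma fmult_fmult_xpow: "fmult sc (c \<star> xpow v k) u = fmult sc c (fmult sc (xpow v k) u)"
proof
  fix e
  have "fmult sc (c \<star> xpow v k) u e = fmult sc c u (e(v := e v - k))"
    by (simp add: fmult_def[of sc "c \<star> xpow v k"] smult_xpow fmult_shift_left)
  also have "\<dots> = fmult sc c (fmult sc (xpow v k) u) e"
    unfolding fmult_def[of _ c] fmult_xpow[OF vector_space_axioms]
    by (intro arg_cong[where f = Sum_any] ext arg_cong2[where f = sc] arg_cong[where f = u])
      (auto simp: fun_eq_iff)
  finally show "fmult sc (c \<star> xpow v k) u e = fmult sc c (fmult sc (xpow v k) u) e" .
qed

section \<open>Common quotients\<close>

text \<open>
  Such distributions form \<open>V((x, y))\<close>, the common part of \<open>V((x))((y))\<close> and \<open>V((y))((x))\<close>.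
\<close>
lemma power_series_times_monomial:
  assumes d: "distinct [x, y, z]" and "bdd_below_in x q" "bdd_below_in y q" "free_of z q"
  obtains p b c where "q = fmult sc (xpow x (- int b)) (fmult sc (xpow y (- int c)) (fps_emb p x y))"
proof -
  obtain M N where M: "\<And>e. e x < M \<Longrightarrow> q e = 0" and N: "\<And>e. e y < N \<Longrightarrow> q e = 0"
    using assms(2,3) by (elim bdd_below_inE) blast
  define b c where "b = nat (- M)" and "c = nat (- N)"
  define p where "p = Abs_fps (\<lambda>j. Abs_fps (\<lambda>i. q ((\<lambda>_. 0)(x := int i - int b, y := int j - int c))))"
  have "q e = fmult sc (xpow x (- int b)) (fmult sc (xpow y (- int c)) (fps_emb p x y)) e" for e
  proof (cases "e x < - int b \<or> e y < - int c \<or> e z \<noteq> 0")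
    case True
    moreover have "- int b \<le> M" "- int c \<le> N" by (auto simp: b_def c_def)
    ultimately have "q e = 0" using M[of e] N[of e] assms(4) by (force simp: free_of_def)
    then show ?thesis using True d
      by (auto simp: fmult_xpow[OF vector_space_axioms] fps_emb_eq[OF d])
  next
    case False
    define e' where "e' = (\<lambda>_. 0)(x := e x, y := e y)"
    have "e v = e' v" for v using False var_cases[OF d, of v] by (auto simp: e'_def)
    then have "q e = q e'" by presburger
    then show ?thesis using False distinct_vars[OF d]
      by (simp add: fmult_xpow[OF vector_space_axioms] fps_emb_eq[OF d] p_def e'_def)
  qed
  then show ?thesis by (intro that[of b c p]) auto
qed

lemma free_of_mult_lin: "z \<noteq> x \<Longrightarrow> z \<noteq> y \<Longrightarrow> free_of z u \<Longrightarrow> free_of z (mult_lin s x t y u)"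
  unfolding free_of_def mult_lin_def by (metis add.right_neutral fun_upd_other scale_zero_right)

text \<open>
  The pattern behind the equivalence of (B) and (E), (C) and (F), (D) and (G). Here \<open>u\<close> and \<open>w\<close> are
  expansions in opposite directions, and so are the two powers on the right-hand side. The product with
  \<open>(s x + t y)\<^sup>m\<close> inherits the bound in \<open>y\<close> from \<open>u\<close> and the bound in \<open>x\<close> from \<open>w\<close>, which makes it a power
  series up to a monomial. Conversely, multiplying both quotients by \<open>(s x + t y)\<^sup>a\<close> gives the same numerator.
\<close>
lemma common_quotient_iff:
  assumes d: "distinct [x, y, z]" and st: "s \<noteq> 0" "t \<noteq> 0"
    and u: "bdd_below_in y u" "free_of z u" and w: "bdd_below_in x w"
  shows "(\<exists>m. (mult_lin s x t y ^^ m) (u - w) = (\<lambda>_. 0)) \<longleftrightarrow> (\<exists>p a b c.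
    u = fmult sc (binom_pow s x t y (- int a))
          (fmult sc (xpow x (- int b)) (fmult sc (xpow y (- int c)) (fps_emb p x y))) \<and>
    w = fmult sc (binom_pow t y s x (- int a))
          (fmult sc (xpow x (- int b)) (fmult sc (xpow y (- int c)) (fps_emb p x y))))"
    (is "?L \<longleftrightarrow> ?R")
proof -
  have xy: "x \<noteq> y" "y \<noteq> x" using d by auto
  have diff: "(mult_lin s x t y ^^ m) (u - w) = (\<lambda>_. 0) \<longleftrightarrow>
      fmult sc (binom_pow s x t y (int m)) u = fmult sc (binom_pow t y s x (int m)) w" for m
    using mult_lin_funpow_diff[of m s x t y u w]
    by (simp add: fun_eq_iff fun_diff_def fmult_binom_pow_nat xy st mult_lin_commute[of t])
  show ?thesis
  proof
    assume ?L
    then obtain m where m: "fmult sc (binom_pow s x t y (int m)) u = fmult sc (binom_pow t y s x (int m)) w"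
      using diff by blast
    define q where "q = fmult sc (binom_pow s x t y (int m)) u"
    have "free_of z ((mult_lin s x t y ^^ j) u)" for j
      by (induction j) (use u d in \<open>auto intro: free_of_mult_lin\<close>)
    then have "free_of z q" by (simp add: q_def fmult_binom_pow_nat xy st)
    moreover have "bdd_below_in y q"
      unfolding q_def by (rule bdd_below_in_fmult_binom_pow) fact+
    moreover have "bdd_below_in x q"
      unfolding q_def m by (rule bdd_below_in_fmult_binom_pow) fact+
    ultimately obtain p b c where
      q: "q = fmult sc (xpow x (- int b)) (fmult sc (xpow y (- int c)) (fps_emb p x y))"
      using power_series_times_monomial[OF d] by metis
    have "u = fmult sc (binom_pow s x t y (- int m)) q"
      by (simp add: q_def fmult_binom_pow_add xy st u fmult_binom_pow_0)
    moreover have "w = fmult sc (binom_pow t y s x (- int m)) q"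
      by (simp add: q_def m fmult_binom_pow_add xy st w fmult_binom_pow_0)
    ultimately show ?R unfolding q by blast
  next
    assume ?R
    then obtain p a b c q where
      q: "q = fmult sc (xpow x (- int b)) (fmult sc (xpow y (- int c)) (fps_emb p x y))"
      and uw: "u = fmult sc (binom_pow s x t y (- int a)) q" "w = fmult sc (binom_pow t y s x (- int a)) q"
      by blast
    have b: "bdd_below_in v (fps_emb p x y)" if "v \<in> {x, y}" for v
      by (rule bdd_below_inI[of _ 0]) (use that in \<open>auto simp: fps_emb_def\<close>)
    have "bdd_below_in v q" if "v \<in> {x, y}" for v
      unfolding q fmult_xpow[OF vector_space_axioms, abs_def]
      by (intro bdd_below_in_shift b that)
    then show ?L
      unfolding diff by (intro exI[of _ a]) (simp add: uw fmult_binom_pow_add xy st fmult_binom_pow_0)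
  qed
qed

section \<open>Terms with delta functions and their residues\<close>

text \<open>
  \<open>z\<^sup>-\<^sup>1 \<delta>((s x + t y) / z) u\<close>, the form of each term of (A).
\<close>
definition delta_term :: "complex \<Rightarrow> var \<Rightarrow> complex \<Rightarrow> var \<Rightarrow> var \<Rightarrow> 'v fdist \<Rightarrow> 'v fdist"
  where "delta_term s x t y z u = fmult sc (xpow z (- 1) \<star> delta s x t y z) u"

text \<open>
  By definition \<open>z\<^sup>-\<^sup>1 \<delta>((s x + t y) / z)\<close> is the sum of all \<open>(s x + t y)\<^sup>n z\<^sup>-\<^sup>n\<^sup>-\<^sup>1\<close>, and \<open>u\<close> does not involve
  \<open>z\<close>; so the exponent of \<open>z\<close> determines \<open>n\<close>.
\<close>
lemma delta_term_eq:
  assumes d: "distinct [x, y, z]" and u: "free_of z u"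
  shows "delta_term s x t y z u e = fmult sc (binom_pow s x t y (- e z - 1)) u (e(z := 0))"
proof -
  have "delta_term s x t y z u e
      = Sum_any (\<lambda>d. sc (binom_pow s x t y (- e z - 1) (d(z := d z - e z))) (u (\<lambda>v. e v - d v)))"
    unfolding delta_term_def fmult_def[of sc]
  proof (intro arg_cong[where f = Sum_any] ext)
    fix c
    show "sc ((xpow z (- 1) \<star> delta s x t y z) c) (u (\<lambda>v. e v - c v))
        = sc (binom_pow s x t y (- e z - 1) (c(z := c z - e z))) (u (\<lambda>v. e v - c v))"
    proof (cases "c z = e z")
      case False
      then have "u (\<lambda>v. e v - c v) = 0" using u by (force simp: free_of_def)
      then show ?thesis by simp
    qed (simp add: delta_eq[OF d])
  qed
  then show ?thesis by (simp add: fmult_shift_left)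
qed

lemma delta_term_res:
  assumes "distinct [x, y, z]" "free_of z u" "e z = - 1"
  shows "delta_term s x t y z u e = u (e(z := 0))"
  using assms by (simp add: delta_term_eq fmult_binom_pow_0)

text \<open>
  The factor \<open>z - (s x + t y)\<close> kills the delta function. All properties of the terms of (A) used below come
  from this relation together with the boundedness and the residues.
\<close>
lemma delta_term_recurrence:
  assumes d: "distinct [x, y, z]" and u: "free_of z u" "bdd_below_in y u" and s: "s \<noteq> 0"
  shows "delta_term s x t y z u (e(z := e z - 1)) = mult_lin s x t y (delta_term s x t y z u) e"
proof -
  have "fmult sc (binom_pow s x t y (- e z - 1 + 1)) u (e(z := 0))
      = mult_lin s x t y (fmult sc (binom_pow s x t y (- e z - 1)) u) (e(z := 0))"
    by (subst fmult_binom_pow_Suc) (use d u s in auto)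
  then show ?thesis
    using distinct_vars[OF d] by (simp add: delta_term_eq[OF d u(1)] mult_lin_def fun_upd_twist)
qed

lemma bdd_below_in_delta_term:
  assumes d: "distinct [x, y, z]" and u: "free_of z u" "bdd_below_in y u"
  shows "bdd_below_in y (delta_term s x t y z u)"
proof -
  obtain N where N: "\<And>e. e y < N \<Longrightarrow> u e = 0" using u(2) by (elim bdd_below_inE) blast
  have "u (e(z := 0, x := a, y := e y - int k)) = 0" if "e y < N" for e a k
    by (rule N) (use that in auto)
  then show ?thesis using d
    by (intro bdd_below_inI[of y N]) (simp add: delta_term_eq[OF d u(1)] fmult_binom_pow_sum[OF d])
qed

text \<open>
  The exponents of \<open>x\<close> and \<open>y\<close> in a term \<open>(s x + t y)\<^sup>m y\<^sup>n\<close> add up to \<open>m + n\<close>, so a coefficient of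
  \<open>f(s x + t y, y)\<close> receives at most one contribution for each exponent \<open>k\<close> of \<open>y\<close> in the binomial.
\<close>
lemma subst_sum:
  assumes d: "distinct [x, y, z]"
  shows "subst sc f s x t y e = (if e z = 0 then Sum_any (\<lambda>k::nat.
    sc ((of_int (e x + int k) gchoose k) * s powi e x * t ^ k)
      (fls_nth (fls_nth f (e y - int k)) (e x + int k))) else 0)"
proof -
  let ?F = "\<lambda>(m, n). sc ((binom_pow s x t y m \<star> xpow y n) e) (fls_nth (fls_nth f n) m)"
  let ?\<phi> = "\<lambda>k::nat. (e x + int k, e y - int k)"
  have "Sum_any ?F = Sum_any (\<lambda>k. ?F (?\<phi> k))"
  proof (rule Sum_any_reindex_inj)
    show "inj ?\<phi>" by (auto simp: inj_def)
    fix mn assume *: "?F mn \<noteq> 0"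
    obtain m n where mn: "mn = (m, n)" by (cases mn)
    have "binom_pow s x t y m (e(y := e y - n)) \<noteq> 0" using * by (auto simp: mn smult_xpow)
    then have "0 \<le> e y - n" "e x = m - (e y - n)"
      using d by (auto simp: binom_pow_eq[OF d] split: if_splits)
    then show "mn \<in> range ?\<phi>" by (intro range_eqI[of _ _ "nat (e y - n)"]) (simp add: mn)
  qed
  then show ?thesis
    using distinct_vars[OF d] by (simp add: subst_def smult_xpow binom_pow_eq[OF d])
qed

lemma bdd_below_in_subst:
  assumes d: "distinct [x, y, z]"
  shows "bdd_below_in y (subst sc f s x t y)"
proof -
  obtain N where "\<forall>n<N. fls_nth f n = 0" using fls_bounded_below by blast
  then show ?thesis by (intro bdd_below_inI[of y N]) (simp add: subst_sum[OF d])
qed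

text \<open>
  For \<open>s = \<plusminus>1\<close>, solving \<open>z = s x + t y\<close> for \<open>x\<close> gives \<open>x = s z - s t y\<close>. Accordingly the delta function is
  \<open>s\<close> times the delta function that substitutes \<open>s z - s t y\<close> for \<open>x\<close>; the factor \<open>s\<close> is the derivative of the
  change of variables. In terms of coefficients this is the reflection of binomial coefficients,
  \<open>(-n-1 choose k) = (-1)\<^sup>k (n+k choose k)\<close>.
\<close>
lemma delta_term_res_subst:
  assumes d: "distinct [x, y, z]" and s: "s = 1 \<or> s = - 1" and e: "e x = - 1"
  shows "delta_term s x t y z (emb f x y) e = sc s (subst sc f s z (- s * t) y (e(x := 0)))"
proof -
  have d': "distinct [z, y, x]" using d by auto
  have fr: "free_of z (emb f x y)" by (auto simp: free_of_def emb_eq[OF d])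
  let ?a = "\<lambda>k::nat. fls_nth (fls_nth f (e y - int k)) (e z + int k)"
  let ?c = "\<lambda>k::nat. (of_int (e z + int k) gchoose k) * s powi e z * (- s * t) ^ k :: complex"
  have coeff: "(of_int (- e z - 1) gchoose k) * s powi (- e z - 1 - int k) * t ^ k = s * ?c k" for k
  proof -
    have "(of_int (- e z - 1) gchoose k) = (- 1) ^ k * (of_int (e z + int k) gchoose k :: complex)"
    proof -
      have "of_int (- e z - 1) = - (of_int (e z) + 1 :: complex)"
        and "of_int (e z + int k) = of_int (e z) + 1 + of_nat k - (1 :: complex)" by simp_all
      then show ?thesis by (simp only: gbinomial_minus)
    qed
    moreover have "s powi (- e z - 1 - int k) = s * s powi e z * s ^ k"
      using s
    proof
      assume s: "s = - 1"
      have "even (- e z - 1 - int k) \<longleftrightarrow> even (1 + e z + int k)" by presburger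
      then have "s powi (- e z - 1 - int k) = s powi (1 + e z + int k)"
        using s by (simp add: power_int_minus_one_minus power_int_minus_left)
      also have "\<dots> = s * s powi e z * s ^ k" using s by (simp add: power_int_add)
      finally show ?thesis .
    qed simp
    ultimately show ?thesis by (simp add: power_mult_distrib algebra_simps power_minus[of "s*t"])
  qed
  have emb: "emb f x y (e(z := 0, x := e z + int k, y := e y - int k)) = ?a k" for k
    using distinct_vars[OF d] by (simp add: emb_eq[OF d])
  have "delta_term s x t y z (emb f x y) e = Sum_any (\<lambda>k::nat. sc s (sc (?c k) (?a k)))"
    using d e coeff emb by (simp add: delta_term_eq[OF d fr] fmult_binom_pow_sum[OF d] algebra_simps)
  also have "\<dots> = sc s (Sum_any (\<lambda>k::nat. sc (?c k) (?a k)))"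
  proof -
    have "{k. sc s (sc (?c k) (?a k)) \<noteq> 0} = {k. sc (?c k) (?a k) \<noteq> 0}" using s by auto
    then show ?thesis by (simp only: Sum_any.expand_set scale_sum_right)
  qed
  also have "\<dots> = sc s (subst sc f s z (- s * t) y (e(x := 0)))"
    using distinct_vars[OF d] by (simp add: subst_sum[OF d'])
  finally show ?thesis .
qed

section \<open>The kernel of x0 - x1 + x2\<close>
definition in_kernel :: "'v fdist \<Rightarrow> bool"
  where "in_kernel T \<longleftrightarrow> (\<forall>e. T (e(X0 := e X0 - 1)) - T (e(X1 := e X1 - 1)) + T (e(X2 := e X2 - 1)) = 0)"

text \<open>
  Multiplication by \<open>a x + b y + c z\<close> is injective on distributions bounded below in \<open>x\<close> and \<open>y\<close>: among the
  terms of \<open>T\<close> of lowest degree in \<open>x\<close>, those of lowest degree in \<open>y\<close> would contribute \<open>c z\<close> times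
  themselves to the product, with nothing to cancel them.
\<close>
lemma bdd_below_in_two_vars_zero:
  assumes d: "distinct [x, y, z]" and c: "c \<noteq> 0"
    and rec: "\<And>e. sc a (T (e(x := e x - 1))) + sc b (T (e(y := e y - 1))) + sc c (T (e(z := e z - 1))) = 0"
    and bdd: "bdd_below_in x T" "bdd_below_in y T"
  shows "T e = 0"
proof -
  obtain M N where M: "\<And>e. e x < M \<Longrightarrow> T e = 0" and N: "\<And>e. e y < N \<Longrightarrow> T e = 0"
    using bdd by (elim bdd_below_inE) blast
  have "T e = 0" if "e x < M + int i" "e y < N + int j" for i j e
    using that
  proof (induction i arbitrary: j e)
    case 0
    then show ?case using M by simp
  next
    case (Suc i)
    note outer = Suc.IH
    show ?case
      using Suc.prems
    proof (induction j arbitrary: e)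
      case 0
      then show ?case using N by simp
    next
      case (Suc j)
      \<comment> \<open>Besides \<open>T e\<close>, the relation at \<open>?e\<close> involves a coefficient of lower degree in \<open>x\<close>, covered by the outer
        induction for every bound on the \<open>y\<close>-degree, and one of equal degree in \<open>x\<close> and lower degree in \<open>y\<close>.\<close>
      let ?e = "e(z := e z + 1)"
      have "T (?e(x := ?e x - 1)) = 0"
        by (rule outer[of _ "Suc j"]) (use Suc.prems d in auto)
      moreover have "T (?e(y := ?e y - 1)) = 0"
        by (rule Suc.IH) (use Suc.prems d in auto)
      ultimately show ?case using rec[of ?e] c by simp
    qed
  qed
  from this[of e "nat (e x - M + 1)" "nat (e y - N + 1)"] show ?thesis by simp
qed

text \<open>
  The coefficient of \<open>z\<^sup>-\<^sup>1\<close>, regarded as a distribution that does not involve \<open>z\<close>.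
\<close>
definition formal_res :: "var \<Rightarrow> 'v fdist \<Rightarrow> 'v fdist"
  where "formal_res z T = (\<lambda>e. if e z = 0 then T (e(z := - 1)) else 0)"

text \<open>
  By \<open>z T = (s x + t y) T\<close>, multiplying the residue by \<open>(s x + t y)\<^sup>m\<close> gives the coefficient of
  \<open>z\<^sup>-\<^sup>1\<^sup>-\<^sup>m\<close> in \<open>T\<close>. If it vanishes, then so do the coefficients of all lower powers of \<open>z\<close>, again by the
  relation.
\<close>
lemma formal_res_annihilated_iff:
  assumes d: "distinct [x, y, z]" and s: "s \<noteq> 0"
    and rec: "\<And>e. T (e(z := e z - 1)) = mult_lin s x t y T e"
  shows "(\<exists>m. fmult sc (binom_pow s x t y (int m)) (formal_res z T) = (\<lambda>_. 0)) \<longleftrightarrow> bdd_below_in z T"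
proof -
  have pow: "(mult_lin s x t y ^^ m) (formal_res z T) = (\<lambda>e. if e z = 0 then T (e(z := - 1 - int m)) else 0)" for m
  proof (induction m)
    case 0
    show ?case by (rule ext) (simp add: formal_res_def fun_upd_def)
  next
    case (Suc m)
    have "mult_lin s x t y (\<lambda>e. if e z = 0 then T (e(z := - 1 - int m)) else 0) e
        = (if e z = 0 then T (e(z := - 1 - int (Suc m))) else 0)" for e
      using rec[of "e(z := - 1 - int m)"] distinct_vars[OF d]
      by (simp add: mult_lin_def fun_upd_twist algebra_simps)
    then show ?case by (simp add: Suc)
  qed
  have iff: "fmult sc (binom_pow s x t y (int m)) (formal_res z T) = (\<lambda>_. 0) \<longleftrightarrow>
      (\<forall>e. e z = - 1 - int m \<longrightarrow> T e = 0)" for m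
  proof -
    have "(\<forall>e. (if e z = 0 then T (e(z := - 1 - int m)) else 0) = 0) \<longleftrightarrow>
        (\<forall>e. e z = - 1 - int m \<longrightarrow> T e = 0)"
    proof (intro iffI allI impI)
      fix e assume *: "\<forall>e. (if e z = 0 then T (e(z := - 1 - int m)) else 0) = 0" and "e z = - 1 - int m"
      then have "e = (e(z := 0))(z := - 1 - int m)" by auto
      then show "T e = 0" using *[rule_format, of "e(z := 0)"] by simp
    qed simp
    then show ?thesis using d s by (simp add: fmult_binom_pow_nat pow fun_eq_iff)
  qed
  show ?thesis unfolding iff
  proof
    assume "\<exists>m. \<forall>e. e z = - 1 - int m \<longrightarrow> T e = 0"
    then obtain m where m: "\<And>e. e z = - 1 - int m \<Longrightarrow> T e = 0" by blast
    have "T e = 0" if "e z = - 1 - int m - int j" for j e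
      using that
    proof (induction j arbitrary: e)
      case 0
      then show ?case using m by simp
    next
      case (Suc j)
      let ?e = "e(z := e z + 1)"
      have "T (?e(x := ?e x - 1)) = 0" "T (?e(y := ?e y - 1)) = 0"
        by (rule Suc.IH; use Suc.prems d in auto)+
      then show ?case using rec[of ?e] by (simp add: mult_lin_def)
    qed
    from this[where j = "nat (- 1 - int m - e z)" and e = e for e]
    have "T e = 0" if "e z < - int m" for e using that by simp
    then show "bdd_below_in z T" by (rule bdd_below_inI)
  next
    assume "bdd_below_in z T"
    then obtain N where "\<And>e. e z < N \<Longrightarrow> T e = 0" by (elim bdd_below_inE) blast
    then show "\<exists>m. \<forall>e. e z = - 1 - int m \<longrightarrow> T e = 0"
      by (intro exI[of _ "nat (- N)"]) auto
  qed
qed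

lemma in_kernel_diff: "in_kernel S \<Longrightarrow> in_kernel T \<Longrightarrow> in_kernel (\<lambda>e. S e - T e)"
  unfolding in_kernel_def by (simp add: algebra_simps)

lemma in_kernel_uminus: "in_kernel T \<Longrightarrow> in_kernel (\<lambda>e. - T e)"
  using in_kernel_diff[of "\<lambda>_. 0" T] by (simp add: in_kernel_def)

section \<open>The three terms of the Jacobi identity\<close>
definition term_f :: "'v fls fls \<Rightarrow> 'v fdist"
  where "term_f f = delta_term 1 X1 (- 1) X2 X0 (emb f X1 X2)"

definition term_g :: "'v fls fls \<Rightarrow> 'v fdist"
  where "term_g g = delta_term (- 1) X2 1 X1 X0 (emb g X2 X1)"

definition term_h :: "'v fls fls \<Rightarrow> 'v fdist"
  where "term_h h = delta_term 1 X2 1 X0 X1 (emb h X2 X0)"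

lemma free_of_emb:
  assumes "distinct [x, y, z]"
  shows "free_of z (emb f x y)"
  by (simp add: free_of_def emb_eq[OF assms])

lemma in_kernel_terms: "in_kernel (term_f f)" "in_kernel (term_g f)" "in_kernel (term_h f)"
proof -
  have r: "delta_term s x t y z (emb f x y) (e(z := e z - 1))
      = mult_lin s x t y (delta_term s x t y z (emb f x y)) e"
    if "distinct [x, y, z]" "s \<noteq> 0" for s x t y z e
    using that delta_term_recurrence free_of_emb bdd_below_in_emb by blast
  show "in_kernel (term_f f)" "in_kernel (term_g f)" "in_kernel (term_h f)"
    unfolding in_kernel_def term_f_def term_g_def term_h_def by (simp_all add: r mult_lin_def)
qed

lemma bdd_below_in_terms: "bdd_below_in X2 (term_f f)" "bdd_below_in X1 (term_g f)" "bdd_below_in X0 (term_h f)"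
  unfolding term_f_def term_g_def term_h_def
  by (intro bdd_below_in_delta_term free_of_emb bdd_below_in_emb; simp)+

text \<open>
  The relation \<open>x\<^sub>0 - x\<^sub>1 + x\<^sub>2\<close> involves all three variables with nonzero coefficients, so any two of them can
  play the role of \<open>x\<close> and \<open>y\<close> in \<open>bdd_below_in_two_vars_zero\<close>.
\<close>
lemma in_kernel_zero:
  assumes "in_kernel T" "bdd_below_in v T" "bdd_below_in w T" "v \<noteq> w"
  shows "T e = 0"
proof -
  obtain z where d: "distinct [v, w, z]" using third_var[OF assms(4)] by blast
  \<comment> \<open>the coefficients of \<open>x\<^sub>0 - x\<^sub>1 + x\<^sub>2\<close>\<close>
  let ?c = "\<lambda>v. if v = X1 then - 1 else 1 :: complex"
  have "sc (?c v) (T (e(v := e v - 1))) + sc (?c w) (T (e(w := e w - 1))) 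
      + sc (?c z) (T (e(z := e z - 1))) = 0" for e
    using d assms(1)[unfolded in_kernel_def, rule_format, of e]
    by (cases v; cases w; cases z) (simp_all add: algebra_simps)
  then show ?thesis by (rule bdd_below_in_two_vars_zero[OF d _ _ assms(2,3), rotated]) simp
qed

lemma statement_A_iff: "statement_A sc f g h \<longleftrightarrow> (\<forall>e. term_f f e - term_g g e - term_h h e = 0)"
  by (simp add: statement_A_def term_f_def term_g_def term_h_def delta_term_def fun_eq_iff fun_diff_def)

text \<open>
  The residue in the denominator of the delta function returns the given series. In the first variable of the
  numerator it is the substituted series, with a sign if that variable has coefficient \<open>-1\<close> in the numerator,
  which occurs only for \<open>g\<close>.
\<close>
lemma formal_res_terms:
  "formal_res X0 (term_f f) = emb f X1 X2" "formal_res X0 (term_g f) = emb f X2 X1"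
  "formal_res X1 (term_h f) = emb f X2 X0"
  "formal_res X1 (term_f f) = subst sc f 1 X0 1 X2"
  "formal_res X2 (\<lambda>e. - term_g f e) = subst sc f (- 1) X0 1 X1"
  "formal_res X2 (term_h f) = subst sc f 1 X1 (- 1) X0"
proof -
  have a: "formal_res z (delta_term s x t y z (emb f x y)) = emb f x y" if d: "distinct [x, y, z]" for s x t y z
    using d by (auto simp: formal_res_def fun_eq_iff delta_term_res[OF d free_of_emb[OF d]] emb_eq[OF d])
  show "formal_res X0 (term_f f) = emb f X1 X2" "formal_res X0 (term_g f) = emb f X2 X1"
    "formal_res X1 (term_h f) = emb f X2 X0"
    unfolding term_f_def term_g_def term_h_def by (rule a; simp)+
  have b: "formal_res x (delta_term s x t y z (emb f x y)) = (\<lambda>e. sc s (subst sc f s z (- s * t) y e))"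
    if d: "distinct [x, y, z]" and s: "s = 1 \<or> s = - 1" for s x t y z
  proof
    fix e :: "var \<Rightarrow> int"
    have d': "distinct [z, y, x]" using d by auto
    have "e(x := 0) = e" if "e x = 0" using that by auto
    moreover have "subst sc f s z (- s * t) y e = 0" if "e x \<noteq> 0"
      using that by (subst subst_sum[OF d']) simp
    ultimately show "formal_res x (delta_term s x t y z (emb f x y)) e = sc s (subst sc f s z (- s * t) y e)"
      by (simp add: formal_res_def delta_term_res_subst[OF d s])
  qed
  show "formal_res X1 (term_f f) = subst sc f 1 X0 1 X2" "formal_res X2 (term_h f) = subst sc f 1 X1 (- 1) X0"
    unfolding term_f_def term_h_def by (simp_all add: b)
  have "formal_res X2 (term_g f) = (\<lambda>e. - subst sc f (- 1) X0 1 X1 e)"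
    unfolding term_g_def by (simp add: b)
  moreover have "formal_res X2 (\<lambda>e. - term_g f e) = (\<lambda>e. - formal_res X2 (term_g f) e)"
    by (auto simp: formal_res_def)
  ultimately show "formal_res X2 (\<lambda>e. - term_g f e) = subst sc f (- 1) X0 1 X1"
    by simp
qed

lemma formal_res_diff: "formal_res z (\<lambda>e. S e - T e) = formal_res z S - formal_res z T"
  by (auto simp: formal_res_def fun_eq_iff)

section \<open>The implications\<close>
lemma statement_B_iff: "statement_B sc f g \<longleftrightarrow> bdd_below_in X0 (\<lambda>e. term_f f e - term_g g e)"
proof -
  have K: "in_kernel (\<lambda>e. term_f f e - term_g g e)" by (intro in_kernel_diff in_kernel_terms)
  show ?thesis
    unfolding statement_B_def formal_res_terms[symmetric] formal_res_diff[symmetric]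
    by (rule formal_res_annihilated_iff) (use K in \<open>simp_all add: in_kernel_def mult_lin_def algebra_simps\<close>)
qed

lemma statement_C_iff: "statement_C sc f h \<longleftrightarrow> bdd_below_in X1 (\<lambda>e. term_f f e - term_h h e)"
proof -
  have K: "in_kernel (\<lambda>e. term_f f e - term_h h e)" by (intro in_kernel_diff in_kernel_terms)
  show ?thesis
    unfolding statement_C_def formal_res_terms(3,4)[symmetric] formal_res_diff[symmetric]
    by (rule formal_res_annihilated_iff) (use K in \<open>simp_all add: in_kernel_def mult_lin_def algebra_simps\<close>)
qed

lemma statement_D_iff: "statement_D sc g h \<longleftrightarrow> bdd_below_in X2 (\<lambda>e. - term_g g e - term_h h e)"
proof -
  have K: "in_kernel (\<lambda>e. - term_g g e - term_h h e)" by (intro in_kernel_diff in_kernel_uminus in_kernel_terms)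
  show ?thesis
    unfolding statement_D_def formal_res_terms(5,6)[symmetric] formal_res_diff[symmetric]
    by (rule formal_res_annihilated_iff) (use K in \<open>simp_all add: in_kernel_def mult_lin_def algebra_simps\<close>)
qed

end

text \<open>
  The factors of the denominators in (F) and (G) are written in another order than in (E). To bring them into
  the same order, the results on the action of distributions are applied to the scalars themselves.
\<close>
lemma complex_vector_space_mult: "complex_vector_space ((*) :: complex \<Rightarrow> _)"
  by unfold_locales (auto simp: algebra_simps)

lemma xpow_smult_commute: "xpow v k \<star> c = c \<star> xpow v k"
proof
  interpret C: complex_vector_space "(*) :: complex \<Rightarrow> _" by (rule complex_vector_space_mult)
  show "(xpow v k \<star> c) e = (c \<star> xpow v k) e" for e
    by (simp add: smult_xpow fmult_xpow[OF C.vector_space_axioms])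
qed

lemma xpow_xpow_smult_commute: "xpow v k \<star> xpow w l \<star> c = c \<star> xpow v k \<star> xpow w l"
proof -
  interpret C: complex_vector_space "(*) :: complex \<Rightarrow> _" by (rule complex_vector_space_mult)
  show ?thesis by (metis C.fmult_fmult_xpow xpow_smult_commute)
qed

context complex_vector_space
begin

lemma statement_B_iff_E: "statement_B sc f g \<longleftrightarrow> statement_E sc f g"
proof -
  have "statement_B sc f g \<longleftrightarrow> (\<exists>m. (mult_lin 1 X1 (- 1) X2 ^^ m) (emb f X1 X2 - emb g X2 X1) = (\<lambda>_. 0))"
    by (simp add: statement_B_def fmult_binom_pow_nat)
  also have "\<dots> \<longleftrightarrow> statement_E sc f g"
    unfolding statement_E_def fmult_fmult_xpow
    by (rule common_quotient_iff[of _ _ X0]) (auto intro: bdd_below_in_emb free_of_emb)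
  finally show ?thesis .
qed

lemma statement_C_iff_F: "statement_C sc f h \<longleftrightarrow> statement_F sc f h"
proof -
  have d: "distinct [X0, X2, X1]" by simp
  have "statement_C sc f h \<longleftrightarrow> (\<exists>m. (mult_lin 1 X0 1 X2 ^^ m) (subst sc f 1 X0 1 X2 - emb h X2 X0) = (\<lambda>_. 0))"
    by (simp add: statement_C_def fmult_binom_pow_nat)
  also have "\<dots> \<longleftrightarrow> statement_F sc f h"
    unfolding statement_F_def xpow_smult_commute[of X0] fmult_fmult_xpow
    by (subst common_quotient_iff[OF d])
      (use d in \<open>auto intro: bdd_below_in_emb bdd_below_in_subst simp: free_of_def subst_sum[OF d]\<close>)
  finally show ?thesis .
qed

lemma statement_D_iff_G: "statement_D sc g h \<longleftrightarrow> statement_G sc g h"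
proof -
  have d: "distinct [X0, X1, X2]" "distinct [X1, X0, X2]" by simp_all
  have "statement_D sc g h \<longleftrightarrow> (\<exists>m. (mult_lin (- 1) X0 1 X1 ^^ m)
      (subst sc g (- 1) X0 1 X1 - subst sc h 1 X1 (- 1) X0) = (\<lambda>_. 0))"
    by (simp add: statement_D_def fmult_binom_pow_nat mult_lin_commute[of "- 1"])
  also have "\<dots> \<longleftrightarrow> statement_G sc g h"
    unfolding statement_G_def xpow_xpow_smult_commute xpow_smult_commute[of X1] fmult_fmult_xpow
    by (subst common_quotient_iff[OF d(1)])
      (use d in \<open>auto intro: bdd_below_in_subst simp: free_of_def subst_sum[OF d(1)]\<close>)
  finally show ?thesis .
qed

lemma statement_A_imp:
  assumes "statement_A sc f g h"
  shows "statement_B sc f g" "statement_C sc f h" "statement_D sc g h"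
proof -
  have "term_f f e = term_g g e + term_h h e" for e
    using assms unfolding statement_A_iff diff_diff_eq by simp
  then have A: "term_f f e - term_g g e = term_h h e" "term_f f e - term_h h e = term_g g e"
    "- term_g g e - term_h h e = - term_f f e" for e by simp_all
  show "statement_B sc f g" "statement_C sc f h" "statement_D sc g h"
    unfolding statement_B_iff statement_C_iff statement_D_iff A
    using bdd_below_in_terms by (simp_all add: bdd_below_in_def)
qed

text \<open>
  Each of the three hypotheses bounds \<open>F - G - H\<close> below in one variable: the term of (A) that does not occur in
  the hypothesis is bounded below in this variable anyway.
\<close>
lemma two_imp_statement_A:
  assumes "statement_B sc f g \<and> statement_C sc f h \<or> statement_B sc f g \<and> statement_D sc g h
    \<or> statement_C sc f h \<and> statement_D sc g h"
  shows "statement_A sc f g h"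
proof -
  let ?T = "\<lambda>e. term_f f e - term_g g e - term_h h e"
  have K: "in_kernel ?T" by (intro in_kernel_diff in_kernel_terms)
  have "bdd_below_in X0 ?T" if "statement_B sc f g"
    by (rule bdd_below_in_combine[OF that[unfolded statement_B_iff] bdd_below_in_terms(3)[of h]]) simp
  moreover have "bdd_below_in X1 ?T" if "statement_C sc f h"
    by (rule bdd_below_in_combine[OF that[unfolded statement_C_iff] bdd_below_in_terms(2)[of g]])
      (simp add: algebra_simps)
  moreover have "bdd_below_in X2 ?T" if "statement_D sc g h"
    by (rule bdd_below_in_combine[OF that[unfolded statement_D_iff] bdd_below_in_terms(1)[of f]])
      (simp add: algebra_simps)
  ultimately obtain v w where "v \<noteq> w" "bdd_below_in v ?T" "bdd_below_in w ?T"
    using assms by (metis var.distinct)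
  then show ?thesis unfolding statement_A_iff using in_kernel_zero[OF K] by blast
qed

end

theorem proposition3p3:
  fixes scale :: "complex \<Rightarrow> 'v::ab_group_add \<Rightarrow> 'v"
    and f g h :: "'v fls fls"
  assumes "vector_space scale"
  shows
    "(statement_A scale f g h \<longrightarrow> statement_B scale f g) \<and>
     (statement_A scale f g h \<longrightarrow> statement_C scale f h) \<and>
     (statement_A scale f g h \<longrightarrow> statement_D scale g h) \<and>
     (statement_B scale f g \<longrightarrow> statement_E scale f g) \<and>
     (statement_C scale f h \<longrightarrow> statement_F scale f h) \<and>
     (statement_D scale g h \<longrightarrow> statement_G scale g h) \<and>
     (statement_E scale f g \<and> statement_F scale f h \<longrightarrow> statement_A scale f g h) \<and>
     (statement_E scale f g \<and> statement_G scale g h \<longrightarrow> statement_A scale f g h) \<and>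
     (statement_F scale f h \<and> statement_G scale g h \<longrightarrow> statement_A scale f g h)"
proof -
  interpret complex_vector_space scale using assms by (simp add: complex_vector_space_def)
  show ?thesis
    using statement_A_imp[of f g h] two_imp_statement_A[of f g h]
      statement_B_iff_E[of f g] statement_C_iff_F[of f h] statement_D_iff_G[of g h] by blast
qed

end
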